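(* Let $\alpha\ge 3$ be an odd integer and let $\epsilon=(\epsilon_1,\dots,\epsilon_{\alpha-1})$ with $\epsilon_i=\epsilon_{\alpha-i}\in\{1,-1\}$ for all $i$. Let $M\in\mathbb{C}\setminus\{0\}$, $\lambda\in\mathbb{C}$, and let $\rho$ be the homomorphism from the free group $F_{x,y}$ on $x,y$ to $SL(2,\mathbb{C})$ with $$\rho(x)=\begin{pmatrix} M & 1\\ 0 & \frac1M\end{pmatrix},\qquad \rho(y)=\begin{pmatrix} M & 0\\ \lambda & \frac1M\end{pmatrix}.$$ Then $\rho$ defines (i.e. factors through) a non-abelian representation of the kmot group $G(\epsilon)$ if and only if $f_{\alpha-1}(M,\tilde\lambda)=0$, where $\tilde\lambda=\lambda+z^2$ and $z=M-M^{-1}$. Furthermore, $f_{\alpha-1}(M,\tilde\lambda)$ is the Riley polynomial of $G(\epsilon)$, i.e., $f_{\alpha-1}(M,\lambda+z^2)=W_{11}-zW_{12}$ in $\mathbb{Z}[M^{\pm1},\lambda]$.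
   Context: The kmot group $G(\epsilon)$ is $\langle x,y\mid wx=yw\rangle$ with $w=x^{\epsilon_1}y^{\epsilon_2}x^{\epsilon_3}y^{\epsilon_4}\cdots x^{\epsilon_{\alpha-2}}y^{\epsilon_{\alpha-1}}$. $W=\rho(w)$ has entries $W_{ij}$, which are polynomials in $\mathbb{Z}[M^{\pm1},\lambda]$; the Riley polynomial of $G(\epsilon)$ is $W_{11}-zW_{12}\in\mathbb{Z}[M^{\pm1},\lambda]$, with $z=M-M^{-1}$. For $n\ge 0$, $0\le k\le n$ and signs $\epsilon_1,\dots,\epsilon_n$, define $$\tilde c_k^n(M,\epsilon)=\sum \epsilon_{i_1}\cdots\epsilon_{i_k}M^{\widehat{i_1\cdots i_k}^{alt}},$$ the sum being over $0<i_1<\cdots<i_k\le n$ with $i_j$ odd for $j$ odd and $i_j$ even for $j$ even; here, if $j_1<\cdots<j_{n-k}$ are the elements of $\{1,\dots,n\}\setminus\{i_1,\dots,i_k\}$, then $\widehat{i_1\cdots i_k}^{alt}=\sum_{r=1}^{n-k}(-1)^r\epsilon_{j_r}$. In particular $\tilde c_0^n=M^{-\epsilon_1+\epsilon_2-\cdots+(-1)^n\epsilon_n}$. Set $$f_{\alpha-1}(M,\tilde\lambda)=\sum_{k=0}^{(\alpha-1)/2}\tilde c_{2k}^{\alpha-1}(M,\epsilon)\,\tilde\lambda^k .$$ *)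

theory Defs
  imports
    "HOL-Analysis.Analysis"
    "HOL-Algebra.Generated_Groups"
    "HOL-Library.Poly_Mapping"
    "HOL-Computational_Algebra.Polynomial"
begin

text \<open>The free group on all elements of a type: freely reduced words in letters
  \<open>(g, True)\<close>, standing for \<open>g\<close>, and \<open>(g, False)\<close>, standing for the inverse of \<open>g\<close>.\<close>

type_synonym 'a fword = "('a \<times> bool) list"

definition inv_letter :: "'a \<times> bool \<Rightarrow> 'a \<times> bool" where
  "inv_letter l = (fst l, \<not> snd l)"

definition reduced :: "'a fword \<Rightarrow> bool" where
  "reduced u \<longleftrightarrow> (\<forall>i. Suc i < length u \<longrightarrow> u ! Suc i \<noteq> inv_letter (u ! i))"

fun cons_letter :: "'a \<times> bool \<Rightarrow> 'a fword \<Rightarrow> 'a fword" where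
  "cons_letter l [] = [l]"
| "cons_letter l (k # u) = (if k = inv_letter l then u else l # k # u)"

definition free_group :: "'a fword monoid" where
  "free_group = \<lparr>carrier = {u. reduced u}, mult = (\<lambda>u v. foldr cons_letter u v), one = []\<rparr>"

definition free_gen :: "'a \<Rightarrow> 'a fword" where
  "free_gen g = [(g, True)]"

definition free_lift :: "('b, 'c) monoid_scheme \<Rightarrow> ('a \<Rightarrow> 'b) \<Rightarrow> 'a fword \<Rightarrow> 'b" where
  "free_lift G \<phi> u =
     foldr (\<lambda>(g, s) r. (if s then \<phi> g else inv\<^bsub>G\<^esub> (\<phi> g)) \<otimes>\<^bsub>G\<^esub> r) u \<one>\<^bsub>G\<^esub>"

definition normal_closure :: "('a, 'b) monoid_scheme \<Rightarrow> 'a set \<Rightarrow> 'a set" where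
  "normal_closure G R =
     generate G {g \<otimes>\<^bsub>G\<^esub> r \<otimes>\<^bsub>G\<^esub> inv\<^bsub>G\<^esub> g | g r. g \<in> carrier G \<and> r \<in> R}"

lemma inv_letter_inv_letter [simp]: "inv_letter (inv_letter l) = l"
  by (simp add: inv_letter_def)

lemma inv_letter_eq_iff: "k = inv_letter l \<longleftrightarrow> l = inv_letter k"
  by (metis inv_letter_inv_letter)

lemma reduced_Nil [simp]: "reduced []"
  by (simp add: reduced_def)

lemma reduced_single [simp]: "reduced [l]"
  by (simp add: reduced_def)

lemma reduced_Cons_Cons [simp]:
  "reduced (l # k # u) \<longleftrightarrow> k \<noteq> inv_letter l \<and> reduced (k # u)"
  unfolding reduced_def
  by (auto simp: nth_Cons split: nat.splits)

lemma reduced_tl: "reduced (l # u) \<Longrightarrow> reduced u"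
  by (cases u) auto

lemma reduced_cons_letter: "reduced u \<Longrightarrow> reduced (cons_letter l u)"
  by (cases u) (auto dest: reduced_tl)

lemma cons_letter_cancel:
  "reduced u \<Longrightarrow> cons_letter l (cons_letter (inv_letter l) u) = u"
  by (cases u; cases "tl u") auto

lemma cons_letter_reduced: "reduced (l # u) \<Longrightarrow> cons_letter l u = l # u"
  by (cases u) auto

lemma reduced_foldr: "reduced v \<Longrightarrow> reduced (foldr cons_letter u v)"
  by (induction u) (auto intro: reduced_cons_letter)

lemma foldr_cons_letter:
  assumes "reduced v"
  shows "foldr cons_letter (cons_letter l u) v = cons_letter l (foldr cons_letter u v)"
proof (cases u)
  case (Cons k u')
  have "cons_letter l (cons_letter (inv_letter l) (foldr cons_letter u' v)) = foldr cons_letter u' v"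
    by (rule cons_letter_cancel) (rule reduced_foldr[OF assms])
  then show ?thesis
    using Cons by auto
qed simp

lemma foldr_cons_letter_assoc:
  assumes "reduced w"
  shows "foldr cons_letter (foldr cons_letter u v) w = foldr cons_letter u (foldr cons_letter v w)"
  by (induction u) (simp_all add: foldr_cons_letter[OF assms])

lemma foldr_cons_letter_Nil: "reduced u \<Longrightarrow> foldr cons_letter u [] = u"
proof (induction u)
  case (Cons l u)
  then show ?case
    using reduced_tl[OF Cons.prems] by (simp add: cons_letter_reduced)
qed simp

lemma foldr_cons_letter_inv:
  assumes "reduced v"
  shows "foldr cons_letter (rev (map inv_letter u)) (foldr cons_letter u v) = v"
  using assms
proof (induction u)
  case (Cons l u)
  have "cons_letter (inv_letter l) (cons_letter l (foldr cons_letter u v)) = foldr cons_letter u v"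
    using cons_letter_cancel[of "foldr cons_letter u v" "inv_letter l"] reduced_foldr[OF Cons.prems]
    by simp
  then show ?case
    using Cons by simp
qed simp

lemma group_free_group: "group free_group"
proof (rule groupI, goal_cases)
  case (5 u)
  let ?v = "foldr cons_letter (rev (map inv_letter u)) []"
  have "foldr cons_letter ?v u = foldr cons_letter (rev (map inv_letter u)) (foldr cons_letter u [])"
    using 5 foldr_cons_letter_assoc[of u "rev (map inv_letter u)" "[]"]
    by (simp add: free_group_def foldr_cons_letter_Nil)
  also have "\<dots> = []"
    by (rule foldr_cons_letter_inv) simp
  finally have "?v \<otimes>\<^bsub>free_group\<^esub> u = \<one>\<^bsub>free_group\<^esub>"
    by (simp add: free_group_def)
  moreover have "?v \<in> carrier free_group"
    by (simp add: free_group_def reduced_foldr)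
  ultimately show ?case
    by blast
qed (auto simp: free_group_def reduced_foldr foldr_cons_letter_assoc)

lemma free_gen_closed: "free_gen g \<in> carrier free_group"
  by (simp add: free_group_def free_gen_def)

lemma free_lift_gen:
  assumes "group G" "\<phi> g \<in> carrier G"
  shows "free_lift G \<phi> (free_gen g) = \<phi> g"
  using assms by (simp add: free_lift_def free_gen_def group.is_monoid)

lemma free_lift_hom:
  fixes G (structure)
  assumes G: "group G" and \<phi>: "\<And>g. \<phi> g \<in> carrier G"
  shows "free_lift G \<phi> \<in> hom free_group G"
proof -
  interpret group G by (rule G)
  define e where "e = (\<lambda>(g, s). if s then \<phi> g else inv \<phi> g)"
  have e: "e l \<in> carrier G" for l
    using \<phi> by (auto simp: e_def split: prod.splits)
  have e_inv: "e l \<otimes> e (inv_letter l) = \<one>" for l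
    using \<phi> by (auto simp: e_def inv_letter_def split: prod.splits)
  have Nil: "free_lift G \<phi> [] = \<one>"
    by (simp add: free_lift_def)
  have Cons: "free_lift G \<phi> (l # u) = e l \<otimes> free_lift G \<phi> u" for l u
    by (cases l) (simp add: free_lift_def e_def)
  have closed: "free_lift G \<phi> u \<in> carrier G" for u
    by (induction u) (simp_all add: Nil Cons e)
  have cons: "free_lift G \<phi> (cons_letter l u) = e l \<otimes> free_lift G \<phi> u" for l u
  proof (cases u)
    case (Cons k v)
    have "e l \<otimes> (e (inv_letter l) \<otimes> free_lift G \<phi> v) = free_lift G \<phi> v"
      using e closed by (simp add: m_assoc[symmetric] e_inv)
    then show ?thesis
      using Cons \<open>\<And>u l. free_lift G \<phi> (l # u) = _\<close> by auto
  qed (simp add: \<open>\<And>u l. free_lift G \<phi> (l # u) = _\<close>)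
  have "free_lift G \<phi> (foldr cons_letter u v) = free_lift G \<phi> u \<otimes> free_lift G \<phi> v" for u v
    by (induction u) (simp_all add: Nil Cons cons closed e m_assoc)
  then show ?thesis
    by (auto simp: hom_def closed free_group_def)
qed

lemma normal_closure_normal:
  fixes G (structure)
  assumes "group G" "R \<subseteq> carrier G"
  shows "normal_closure G R \<lhd> G"
proof -
  interpret group G by fact
  show ?thesis
    unfolding normal_closure_def
  proof (rule normal_generateI)
    show "{g \<otimes> r \<otimes> inv g | g r. g \<in> carrier G \<and> r \<in> R} \<subseteq> carrier G"
      using assms by auto
  next
    fix h k
    assume "h \<in> {g \<otimes> r \<otimes> inv g | g r. g \<in> carrier G \<and> r \<in> R}" and k: "k \<in> carrier G"
    then obtain g r where g: "h = g \<otimes> r \<otimes> inv g" "g \<in> carrier G" "r \<in> R"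
      by auto
    then have "k \<otimes> h \<otimes> inv k = (k \<otimes> g) \<otimes> r \<otimes> inv (k \<otimes> g)"
      using k assms(2) by (auto simp: m_assoc inv_mult_group)
    then show "k \<otimes> h \<otimes> inv k \<in> {g \<otimes> r \<otimes> inv g | g r. g \<in> carrier G \<and> r \<in> R}"
      using k g by blast
  qed
qed

datatype xy = X | Y

abbreviation F_xy :: "xy fword monoid" where
  "F_xy \<equiv> free_group"

definition kmot_word :: "nat \<Rightarrow> (nat \<Rightarrow> int) \<Rightarrow> xy fword" where
  "kmot_word \<alpha> \<epsilon> =
     foldr (\<lambda>i u. (free_gen (if odd i then X else Y) [^]\<^bsub>F_xy\<^esub> \<epsilon> i) \<otimes>\<^bsub>F_xy\<^esub> u)
       [1..<\<alpha>] \<one>\<^bsub>F_xy\<^esub>"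

definition kmot_relator :: "nat \<Rightarrow> (nat \<Rightarrow> int) \<Rightarrow> xy fword" where
  "kmot_relator \<alpha> \<epsilon> =
     (kmot_word \<alpha> \<epsilon> \<otimes>\<^bsub>F_xy\<^esub> free_gen X) \<otimes>\<^bsub>F_xy\<^esub>
     inv\<^bsub>F_xy\<^esub> (free_gen Y \<otimes>\<^bsub>F_xy\<^esub> kmot_word \<alpha> \<epsilon>)"

definition kmot_kernel :: "nat \<Rightarrow> (nat \<Rightarrow> int) \<Rightarrow> xy fword set" where
  "kmot_kernel \<alpha> \<epsilon> = normal_closure F_xy {kmot_relator \<alpha> \<epsilon>}"

definition kmot_group :: "nat \<Rightarrow> (nat \<Rightarrow> int) \<Rightarrow> xy fword set monoid" where
  "kmot_group \<alpha> \<epsilon> = F_xy Mod kmot_kernel \<alpha> \<epsilon>"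

definition kmot_proj :: "nat \<Rightarrow> (nat \<Rightarrow> int) \<Rightarrow> xy fword \<Rightarrow> xy fword set" where
  "kmot_proj \<alpha> \<epsilon> u = kmot_kernel \<alpha> \<epsilon> #>\<^bsub>F_xy\<^esub> u"

lemma kmot_word_closed: "kmot_word \<alpha> \<epsilon> \<in> carrier F_xy"
proof -
  interpret group F_xy by (rule group_free_group)
  have "foldr (\<lambda>i u. (free_gen (if odd i then X else Y) [^]\<^bsub>F_xy\<^esub> \<epsilon> i) \<otimes>\<^bsub>F_xy\<^esub> u) is \<one>\<^bsub>F_xy\<^esub>
          \<in> carrier F_xy" for "is"
    by (induction "is") (auto intro!: m_closed int_pow_closed free_gen_closed)
  then show ?thesis
    by (simp add: kmot_word_def)
qed

lemma kmot_kernel_normal: "kmot_kernel \<alpha> \<epsilon> \<lhd> F_xy"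
proof -
  interpret group F_xy by (rule group_free_group)
  show ?thesis
    unfolding kmot_kernel_def kmot_relator_def
    by (rule normal_closure_normal)
       (auto intro!: m_closed inv_closed free_gen_closed kmot_word_closed group_free_group)
qed

lemma group_kmot_group: "group (kmot_group \<alpha> \<epsilon>)"
  unfolding kmot_group_def by (rule normal.factorgroup_is_group[OF kmot_kernel_normal])

lemma kmot_proj_hom: "kmot_proj \<alpha> \<epsilon> \<in> hom F_xy (kmot_group \<alpha> \<epsilon>)"
  unfolding kmot_group_def kmot_proj_def
  by (rule normal.r_coset_hom_Mod[OF kmot_kernel_normal])

definition mat2 :: "'a \<Rightarrow> 'a \<Rightarrow> 'a \<Rightarrow> 'a \<Rightarrow> 'a::zero ^ 2 ^ 2" where
  "mat2 a b c d = vector [vector [a, b], vector [c, d]]"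

definition SL2 :: "('a::comm_ring_1 ^ 2 ^ 2) monoid" where
  "SL2 = \<lparr>carrier = {A. det A = 1}, mult = (**), one = mat 1\<rparr>"

lemma mat2_nth [simp]:
  "mat2 a b c d $ 1 $ 1 = a" "mat2 a b c d $ 1 $ 2 = b"
  "mat2 a b c d $ 2 $ 1 = c" "mat2 a b c d $ 2 $ 2 = d"
  by (simp_all add: mat2_def)

lemma group_SL2: "group (SL2 :: ('a::comm_ring_1 ^ 2 ^ 2) monoid)"
proof (rule groupI, goal_cases)
  case (5 A)
  let ?B = "mat2 (A$2$2) (- A$1$2) (- A$2$1) (A$1$1)"
  have "?B \<otimes>\<^bsub>SL2\<^esub> A = \<one>\<^bsub>SL2\<^esub>" "?B \<in> carrier SL2"
    using 5
    by (auto simp: SL2_def det_2 vec_eq_iff forall_2 matrix_matrix_mult_def sum_2 mat_def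
          algebra_simps)
  then show ?case
    by blast
qed (auto simp: SL2_def det_mul det_I matrix_mul_assoc)

definition nonabelian_rep :: "('a, 'c) monoid_scheme \<Rightarrow> ('b, 'd) monoid_scheme \<Rightarrow> ('a \<Rightarrow> 'b) \<Rightarrow> bool" where
  "nonabelian_rep G H \<phi> \<longleftrightarrow> \<phi> \<in> hom G H \<and>
     (\<exists>a\<in>carrier G. \<exists>b\<in>carrier G. \<phi> a \<otimes>\<^bsub>H\<^esub> \<phi> b \<noteq> \<phi> b \<otimes>\<^bsub>H\<^esub> \<phi> a)"

text \<open>\<open>\<int>[M, M\<^sup>-\<^sup>1]\<close> is the group ring of the additive group \<open>\<int>\<close>: finitely supported functions
  from exponents to coefficients under convolution.\<close>

type_synonym laurent = "int \<Rightarrow>\<^sub>0 int"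

abbreviation Mpow :: "int \<Rightarrow> laurent" where
  "Mpow k \<equiv> Poly_Mapping.single k 1"

definition laurent_eval :: "complex \<Rightarrow> laurent \<Rightarrow> complex" where
  "laurent_eval M p = (\<Sum>k\<in>Poly_Mapping.keys p. of_int (Poly_Mapping.lookup p k) * M powi k)"

definition eval_at :: "complex \<Rightarrow> complex \<Rightarrow> laurent poly \<Rightarrow> complex" where
  "eval_at M t p = poly (map_poly (laurent_eval M) p) t"

text \<open>The representation of \<open>F_xy\<close> with \<open>M\<close> and \<open>\<lambda>\<close> indeterminates, over
  \<open>\<int>[M, M\<^sup>-\<^sup>1, \<lambda>] = \<int>[M, M\<^sup>-\<^sup>1][\<lambda>]\<close>.\<close>

definition generic_rho :: "xy fword \<Rightarrow> laurent poly ^ 2 ^ 2" where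
  "generic_rho = free_lift SL2
     (\<lambda>g. case g of
        X \<Rightarrow> mat2 [:Mpow 1:] 1 0 [:Mpow (-1):]
      | Y \<Rightarrow> mat2 [:Mpow 1:] 0 [:0, 1:] [:Mpow (-1):])"

definition z_laurent :: laurent where
  "z_laurent = Mpow 1 - Mpow (-1)"

definition riley_poly :: "nat \<Rightarrow> (nat \<Rightarrow> int) \<Rightarrow> laurent poly" where
  "riley_poly \<alpha> \<epsilon> =
     (let W = generic_rho (kmot_word \<alpha> \<epsilon>) in W $ 1 $ 1 - [:z_laurent:] * W $ 1 $ 2)"

lemma generic_rho:
  "generic_rho \<in> hom F_xy SL2"
  "generic_rho (free_gen X) = mat2 [:Mpow 1:] 1 0 [:Mpow (-1):]"
  "generic_rho (free_gen Y) = mat2 [:Mpow 1:] 0 [:0, 1:] [:Mpow (-1):]"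
proof -
  let ?\<phi> = "\<lambda>g. case g of
        X \<Rightarrow> mat2 [:Mpow 1:] 1 0 [:Mpow (-1):]
      | Y \<Rightarrow> mat2 [:Mpow 1:] 0 [:0, 1:] [:Mpow (-1):]"
  have c: "?\<phi> g \<in> carrier SL2" for g
    by (cases g) (simp_all add: SL2_def det_2 mult_single one_pCons)
  show "generic_rho \<in> hom F_xy SL2"
    unfolding generic_rho_def by (rule free_lift_hom[OF group_SL2 c])
  show "generic_rho (free_gen X) = mat2 [:Mpow 1:] 1 0 [:Mpow (-1):]"
    unfolding generic_rho_def
    using free_lift_gen[where \<phi> = ?\<phi> and g = X, OF group_SL2 c] by simp
  show "generic_rho (free_gen Y) = mat2 [:Mpow 1:] 0 [:0, 1:] [:Mpow (-1):]"
    unfolding generic_rho_def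
    using free_lift_gen[where \<phi> = ?\<phi> and g = Y, OF group_SL2 c] by simp
qed

text \<open>Index sequences \<open>0 < i\<^sub>1 < \<dots> < i\<^sub>k \<le> n\<close> with \<open>i\<^sub>j \<equiv> j (mod 2)\<close>; list positions
  start at 0, so \<open>i\<^sub>j\<close> is at position \<open>j - 1\<close>.\<close>

definition alt_seqs :: "nat \<Rightarrow> nat \<Rightarrow> nat list set" where
  "alt_seqs n k = {is. length is = k \<and> sorted_wrt (<) is \<and> set is \<subseteq> {1..n} \<and>
     (\<forall>j<k. odd (is ! j) \<longleftrightarrow> odd (Suc j))}"

definition alt_hat :: "(nat \<Rightarrow> int) \<Rightarrow> nat \<Rightarrow> nat list \<Rightarrow> int" where
  "alt_hat \<epsilon> n is =
     (let js = sorted_list_of_set ({1..n} - set is)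
      in \<Sum>r<length js. (-1) ^ Suc r * \<epsilon> (js ! r))"

definition ctilde :: "(nat \<Rightarrow> int) \<Rightarrow> nat \<Rightarrow> nat \<Rightarrow> laurent" where
  "ctilde \<epsilon> n k =
     (\<Sum>is\<in>alt_seqs n k. of_int (\<Prod>j<k. \<epsilon> (is ! j)) * Mpow (alt_hat \<epsilon> n is))"

text \<open>\<open>f\<^sub>n\<close> for even \<open>n\<close>, with the polynomial variable standing for \<open>\<lambda>\<close>-tilde.\<close>

definition f_poly :: "(nat \<Rightarrow> int) \<Rightarrow> nat \<Rightarrow> laurent poly" where
  "f_poly \<epsilon> n = (\<Sum>k=0..n div 2. monom (ctilde \<epsilon> n (2 * k)) k)"

lemma finite_alt_seqs: "finite (alt_seqs n k)"
  by (rule finite_subset[OF _ finite_lists_length_eq[of "{1..n}" k]]) (auto simp: alt_seqs_def)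

end

theory Submission
  imports Defs
begin

text \<open>Conjugating by the unipotent matrix with first column \<open>(1, -z)\<close>, the first column being an
  eigenvector of \<open>\<rho> x\<close>, makes \<open>\<rho> x\<close> upper and \<open>\<rho> y\<close> lower triangular with \<open>\<lambda>\<close> replaced by
  \<open>\<lambda> + z\<^sup>2\<close>, and turns \<open>W\<^sub>1\<^sub>1 - z W\<^sub>1\<^sub>2\<close> into the top left entry of the conjugated product. Expanding
  this entry factor by factor gives the recurrence in \<open>n\<close> of the coefficients \<open>ctilde\<close>.
  The palindromic symmetry of the signs gives \<open>W\<^sub>2\<^sub>1 = \<lambda> W\<^sub>1\<^sub>2\<close>, which reduces the matrix relation
  \<open>W \<rho>(x) = \<rho>(y) W\<close> to the vanishing of \<open>W\<^sub>1\<^sub>1 - z W\<^sub>1\<^sub>2\<close>.\<close>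

section \<open>Recurrence for the coefficients\<close>

lemma alt_seqs_0 [simp]: "alt_seqs n 0 = {[]}"
  by (auto simp: alt_seqs_def)

lemma alt_seqsD:
  assumes "is \<in> alt_seqs n k"
  shows "length is = k" "set is \<subseteq> {1..n}" "distinct is"
  using assms by (auto simp: alt_seqs_def strict_sorted_iff)

lemma alt_seqs_le:
  assumes "is \<in> alt_seqs n k"
  shows "k \<le> n"
  using card_mono[OF _ alt_seqsD(2)[OF assms]] alt_seqsD[OF assms] by (simp add: distinct_card)

lemma ctilde_eq_0: "n < k \<Longrightarrow> ctilde \<epsilon> n k = 0"
  using alt_seqs_le[of _ n k] by (auto simp: ctilde_def intro!: sum.neutral)

text \<open>The last entry is at position \<open>k\<close> counted from 0, so its parity is opposite
  to that of \<open>k\<close>. Strict increase confines the earlier entries to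
  \<open>{1..i - 1}\<close>.\<close>

lemma alt_seqs_snoc_iff:
  "is @ [i] \<in> alt_seqs n (Suc k) \<longleftrightarrow>
     is \<in> alt_seqs (i - 1) k \<and> 0 < i \<and> i \<le> n \<and> (odd i \<longleftrightarrow> even k)"
  by (fastforce simp: alt_seqs_def sorted_wrt_append less_Suc_eq nth_append)

lemma alt_seqs_Suc_Suc:
  "alt_seqs (Suc n) (Suc k) =
     alt_seqs n (Suc k) \<union> (if even (n + k) then (\<lambda>is. is @ [Suc n]) ` alt_seqs n k else {})"
  (is "?L = ?R")
proof (rule Set.set_eqI)
  fix js
  show "js \<in> ?L \<longleftrightarrow> js \<in> ?R"
  proof (cases js rule: rev_cases)
    case Nil
    then show ?thesis by (auto simp: alt_seqs_def)
  next
    case (snoc "is" i)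
    then show ?thesis
      by (auto simp: alt_seqs_snoc_iff le_Suc_eq)
  qed
qed

lemma sorted_list_of_set_insert_greatest:
  assumes "finite A" "\<And>a. a \<in> A \<Longrightarrow> a < x"
  shows "sorted_list_of_set (insert x A) = sorted_list_of_set A @ [x]"
  using sorted_list_of_set.idem_if_sorted_distinct[of "sorted_list_of_set A @ [x]"] assms
  by (force simp: sorted_append)

text \<open>The index \<open>Suc n\<close> is the largest omitted one and follows
  \<open>n - k\<close> other omitted indices, so only the sign of this last summand has to be
  found.\<close>

lemma alt_hat_Suc:
  assumes "is \<in> alt_seqs n k"
  shows "alt_hat \<epsilon> (Suc n) is = alt_hat \<epsilon> n is + (if even (n + k) then - \<epsilon> (Suc n) else \<epsilon> (Suc n))"
proof -
  have "{1..Suc n} - set is = insert (Suc n) ({1..n} - set is)"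
    using alt_seqsD(2)[OF assms] by auto
  then have "sorted_list_of_set ({1..Suc n} - set is) =
      sorted_list_of_set ({1..n} - set is) @ [Suc n]"
    by (simp only:) (rule sorted_list_of_set_insert_greatest; force)
  moreover have "length (sorted_list_of_set ({1..n} - set is)) = n - k"
    using alt_seqsD[OF assms] by (simp add: card_Diff_subset distinct_card)
  \<comment> \<open>Since \<open>k \<le> n\<close>, the subtraction does not truncate, and
    \<open>n - k\<close> has the parity of \<open>n + k\<close>.\<close>
  moreover have "(-1) ^ (n - k) = (if even (n + k) then 1 else - 1 :: int)"
    using alt_seqs_le[OF assms] by (auto simp: minus_one_power_iff)
  ultimately show ?thesis
    by (simp add: alt_hat_def Let_def nth_append)
qed

lemma alt_hat_Suc_snoc:
  assumes "is \<in> alt_seqs n k"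
  shows "alt_hat \<epsilon> (Suc n) (is @ [Suc n]) = alt_hat \<epsilon> n is"
proof -
  have "{1..Suc n} - set (is @ [Suc n]) = {1..n} - set is"
    by auto
  then show ?thesis
    by (simp only: alt_hat_def)
qed

text \<open>Index sequences are split by whether they use \<open>Suc n\<close>. Those that avoid it
  gain a power of \<open>M\<close>. Those that end in it gain the sign
  \<open>\<epsilon> (Suc n)\<close> and keep their exponent.\<close>

lemma ctilde_Suc:
  "ctilde \<epsilon> (Suc n) k =
     Mpow (if even (n + k) then - \<epsilon> (Suc n) else \<epsilon> (Suc n)) * ctilde \<epsilon> n k
     + (if odd (n + k) \<and> 0 < k then of_int (\<epsilon> (Suc n)) * ctilde \<epsilon> n (k - 1) else 0)"
proof -
  let ?t = "\<lambda>n k is. of_int (\<Prod>j<k. \<epsilon> (is ! j)) * Mpow (alt_hat \<epsilon> n is)"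
  let ?s = "if even (n + k) then - \<epsilon> (Suc n) else \<epsilon> (Suc n)"
  have stay: "(\<Sum>is\<in>alt_seqs n k. ?t (Suc n) k is) = Mpow ?s * ctilde \<epsilon> n k"
    unfolding ctilde_def sum_distrib_left
    by (intro sum.cong refl)
       (subst alt_hat_Suc, assumption, simp add: mult_ac mult_single add_ac)
  show ?thesis
  proof (cases k)
    case 0
    then have "alt_seqs (Suc n) k = alt_seqs n k"
      by simp
    then have "ctilde \<epsilon> (Suc n) k = (\<Sum>is\<in>alt_seqs n k. ?t (Suc n) k is)"
      by (simp only: ctilde_def)
    then show ?thesis
      unfolding stay using 0 by simp
  next
    case (Suc k')
    let ?S = "if even (n + k') then (\<lambda>is. is @ [Suc n]) ` alt_seqs n k' else {}"
    have disj: "alt_seqs n k \<inter> ?S = {}"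
      by (auto simp: alt_seqs_def)
    have "ctilde \<epsilon> (Suc n) k = (\<Sum>is\<in>alt_seqs n k. ?t (Suc n) k is) + (\<Sum>is\<in>?S. ?t (Suc n) k is)"
      unfolding ctilde_def Suc alt_seqs_Suc_Suc
      by (rule sum.union_disjoint) (use disj Suc in \<open>auto simp: finite_alt_seqs\<close>)
    moreover have "(\<Sum>is\<in>(\<lambda>is. is @ [Suc n]) ` alt_seqs n k'. ?t (Suc n) k is)
        = of_int (\<epsilon> (Suc n)) * ctilde \<epsilon> n k'"
    proof -
      have "?t (Suc n) k (is @ [Suc n]) = of_int (\<epsilon> (Suc n)) * ?t n k' is"
        if "is \<in> alt_seqs n k'" for "is"
        using alt_seqsD(1)[OF that] Suc by (simp add: alt_hat_Suc_snoc[OF that] nth_append)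
      then show ?thesis
        by (simp add: sum.reindex inj_on_def ctilde_def sum_distrib_left)
    qed
    ultimately show ?thesis
      unfolding stay using Suc by auto
  qed
qed

section \<open>Evaluation of Laurent polynomials\<close>

text \<open>Lets several Laurent polynomials be evaluated over one common finite set of
  exponents.\<close>

lemma laurent_eval_eq:
  assumes "finite S" "Poly_Mapping.keys p \<subseteq> S"
  shows "laurent_eval M p = (\<Sum>k\<in>S. of_int (Poly_Mapping.lookup p k) * M powi k)"
  unfolding laurent_eval_def
  by (rule sum.mono_neutral_left) (use assms in \<open>auto simp: in_keys_iff\<close>)

lemma laurent_eval_single [simp]: "laurent_eval M (Poly_Mapping.single k c) = of_int c * M powi k"
  by (subst laurent_eval_eq[of "{k}"]) auto

lemma laurent_eval_0 [simp]: "laurent_eval M 0 = 0"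
  by (simp add: laurent_eval_def)

lemma laurent_eval_diff: "laurent_eval M (p - q) = laurent_eval M p - laurent_eval M q"
proof -
  let ?S = "Poly_Mapping.keys p \<union> Poly_Mapping.keys q"
  have "Poly_Mapping.keys (p - q) \<subseteq> ?S"
    by (auto simp: in_keys_iff lookup_minus)
  then show ?thesis
    by (simp add: laurent_eval_eq[of ?S] lookup_minus sum_subtractf algebra_simps)
qed

lemma laurent_eval_add: "laurent_eval M (p + q) = laurent_eval M p + laurent_eval M q"
  using laurent_eval_diff[of M p "- q"] laurent_eval_diff[of M 0 q] by simp

text \<open>Both sides are additive in each argument, so the exponent law for powers of the nonzero
  \<open>M\<close> suffices. \<open>frag_induction\<close> builds Laurent polynomials from zero, the
  \<open>Mpow k\<close> and differences.\<close>

lemma laurent_eval_mult: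
  assumes "M \<noteq> 0"
  shows "laurent_eval M (p * q) = laurent_eval M p * laurent_eval M q"
proof -
  have 1: "laurent_eval M (Mpow k * q) = M powi k * laurent_eval M q" for k q
    using subset_UNIV[of "Poly_Mapping.keys q"]
  proof (induction q rule: frag_induction)
    case (one x)
    then show ?case
      using assms by (simp add: mult_single power_int_add)
  qed (simp_all add: laurent_eval_diff algebra_simps)
  show ?thesis
    using subset_UNIV[of "Poly_Mapping.keys p"]
  proof (induction p rule: frag_induction)
    case (one x)
    then show ?case
      using 1 by simp
  qed (simp_all add: laurent_eval_diff algebra_simps)
qed

lemma laurent_eval_of_int [simp]: "laurent_eval M (of_int c) = of_int c"
  by (simp flip: single_of_int)

lemma laurent_eval_sum: "laurent_eval M (sum g A) = (\<Sum>a\<in>A. laurent_eval M (g a))"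
  by (induction A rule: infinite_finite_induct) (simp_all add: laurent_eval_add)

lemma eval_at_f_poly:
  "eval_at M t (f_poly \<epsilon> n) = (\<Sum>k=0..n div 2. laurent_eval M (ctilde \<epsilon> n (2 * k)) * t ^ k)"
proof -
  have "map_poly (laurent_eval M) (f_poly \<epsilon> n) =
      (\<Sum>k=0..n div 2. monom (laurent_eval M (ctilde \<epsilon> n (2 * k))) k)"
    by (rule poly_eqI)
       (simp add: coeff_map_poly f_poly_def coeff_sum laurent_eval_sum if_distrib cong: if_cong)
  then show ?thesis
    by (simp add: eval_at_def poly_sum poly_monom)
qed

lemma pcompose_f_poly:
  "pcompose (f_poly \<epsilon> n) q = (\<Sum>k=0..n div 2. [:ctilde \<epsilon> n (2 * k):] * q ^ k)"
proof -
  have "pcompose (monom c k) q = [:c:] * q ^ k" for c :: laurent and k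
    by (induction k) (simp_all add: monom_Suc pcompose_pCons monom_0 mult_ac)
  then show ?thesis
    by (simp add: f_poly_def pcompose_sum)
qed

section \<open>Representations of the kmot word\<close>

lemma mat2_eq_iff:
  "A = B \<longleftrightarrow> A $ 1 $ 1 = B $ 1 $ 1 \<and> A $ 1 $ 2 = B $ 1 $ 2 \<and> A $ 2 $ 1 = B $ 2 $ 1 \<and> A $ 2 $ 2 = B $ 2 $ 2"
  for A B :: "'a ^ 2 ^ 2"
  by (auto simp: vec_eq_iff forall_2)

lemma matrix_mult_2: "(A ** B) $ i $ j = A $ i $ 1 * B $ 1 $ j + A $ i $ 2 * B $ 2 $ j"
  for A B :: "'a::semiring_1 ^ 2 ^ 2"
  by (simp add: matrix_matrix_mult_def sum_2)

lemma inv_SL2: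
  assumes "a * d - b * c = (1 :: 'a::comm_ring_1)"
  shows "inv\<^bsub>SL2\<^esub> (mat2 a b c d) = mat2 d (- b) (- c) a"
proof -
  interpret SL2: group "SL2 :: ('a ^ 2 ^ 2) monoid"
    by (rule group_SL2)
  show ?thesis
    by (rule SL2.inv_equality)
       (use assms in \<open>auto simp: SL2_def det_2 mat2_eq_iff matrix_mult_2 mat_def algebra_simps\<close>)
qed

text \<open>For invertible \<open>l\<close> this says that \<open>B\<close> is the transpose of
  \<open>A\<close> conjugated by the diagonal matrix with entries \<open>l\<close> and 1. Avoiding
  division keeps \<open>l = 0\<close> and polynomial rings within reach. Like transposition, it
  reverses products, and it exchanges the images of \<open>x\<close> and \<open>y\<close>.\<close>

definition flipped :: "'a::comm_ring_1 \<Rightarrow> 'a ^ 2 ^ 2 \<Rightarrow> 'a ^ 2 ^ 2 \<Rightarrow> bool" where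
  "flipped l A B \<longleftrightarrow> A $ 1 $ 1 = B $ 1 $ 1 \<and> A $ 2 $ 2 = B $ 2 $ 2 \<and>
     A $ 2 $ 1 = l * B $ 1 $ 2 \<and> B $ 2 $ 1 = l * A $ 1 $ 2"

lemma flipped_mult:
  assumes "flipped l A A'" "flipped l B B'"
  shows "flipped l (A ** B) (B' ** A')"
  using assms by (simp add: flipped_def matrix_mult_2 algebra_simps)

lemma flipped_one: "flipped l (mat 1) (mat 1)"
  by (simp add: flipped_def mat_def)

text \<open>A general commutative ring covers both the given complex matrices and the generic ones
  over \<open>laurent poly\<close>. The inverse \<open>m'\<close> is a parameter because the ring
  need not have division.\<close>

locale kmot_rep =
  fixes \<alpha> :: nat and \<epsilon> :: "nat \<Rightarrow> int" and m m' l :: "'a::comm_ring_1"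
    and \<rho> :: "xy fword \<Rightarrow> 'a ^ 2 ^ 2"
  assumes sign: "\<And>i. i \<in> {1..<\<alpha>} \<Longrightarrow> \<epsilon> i = 1 \<or> \<epsilon> i = - 1"
    and inverse: "m * m' = 1"
    and hom_rho: "\<rho> \<in> hom F_xy SL2"
    and rho_X: "\<rho> (free_gen X) = mat2 m 1 0 m'"
    and rho_Y: "\<rho> (free_gen Y) = mat2 m 0 l m'"
begin

sublocale group_hom F_xy "SL2 :: ('a ^ 2 ^ 2) monoid" \<rho>
  by (simp add: group_hom_def group_hom_axioms_def group_free_group group_SL2 hom_rho)

definition factor :: "nat \<Rightarrow> 'a ^ 2 ^ 2" where
  "factor i = \<rho> (free_gen (if odd i then X else Y) [^]\<^bsub>F_xy\<^esub> \<epsilon> i)"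

definition factors :: "nat list \<Rightarrow> 'a ^ 2 ^ 2" where
  "factors is = foldr (\<lambda>i A. factor i ** A) is (mat 1)"

lemma factors_simps [simp]:
  "factors [] = mat 1" "factors (i # is) = factor i ** factors is"
  "factors (is @ js) = factors is ** factors js"
proof -
  show 1: "factors [] = mat 1" "factors (i # is) = factor i ** factors is" for i "is"
    by (simp_all add: factors_def)
  show "factors (is @ js) = factors is ** factors js"
    by (induction "is") (simp_all add: 1 matrix_mul_assoc)
qed

lemma rho_kmot_word: "\<rho> (kmot_word \<alpha> \<epsilon>) = factors [1..<\<alpha>]"
proof -
  let ?w = "\<lambda>is. foldr (\<lambda>i u. (free_gen (if odd i then X else Y) [^]\<^bsub>F_xy\<^esub> \<epsilon> i) \<otimes>\<^bsub>F_xy\<^esub> u) is \<one>\<^bsub>F_xy\<^esub>"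
  have "?w is \<in> carrier F_xy \<and> \<rho> (?w is) = factors is" for "is"
  proof (induction "is")
    case Nil
    have "\<rho> \<one>\<^bsub>F_xy\<^esub> = \<one>\<^bsub>SL2\<^esub>"
      by (rule hom_one)
    then show ?case
      by (simp add: SL2_def)
  next
    case (Cons i "is")
    then show ?case
      by (simp add: factor_def free_gen_closed) (simp add: SL2_def)
  qed
  then show ?thesis
    unfolding kmot_word_def by blast
qed

lemma factor:
  assumes "i \<in> {1..<\<alpha>}"
  shows "factor i =
    (let u = if \<epsilon> i = 1 then m else m'; v = if \<epsilon> i = 1 then m' else m
     in if odd i then mat2 u (of_int (\<epsilon> i)) 0 v else mat2 u 0 (of_int (\<epsilon> i) * l) v)"
  using sign[OF assms] inverse
  by (auto simp: factor_def G.int_pow_neg G.int_pow_1 free_gen_closed rho_X rho_Y inv_SL2)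

text \<open>As \<alpha> is odd, \<open>i\<close> and \<open>\<alpha> - i\<close> have opposite
  parity, so a power of \<open>x\<close> meets the power of \<open>y\<close> with the same
  exponent.\<close>

lemma flipped_factor:
  assumes "odd \<alpha>" "\<And>i. i \<in> {1..<\<alpha>} \<Longrightarrow> \<epsilon> i = \<epsilon> (\<alpha> - i)" "i \<in> {1..<\<alpha>}"
  shows "flipped l (factor i) (factor (\<alpha> - i))"
proof -
  have "\<alpha> - i \<in> {1..<\<alpha>}" "odd (\<alpha> - i) \<longleftrightarrow> even i" "\<epsilon> (\<alpha> - i) = \<epsilon> i"
    using assms by auto
  then show ?thesis
    using assms(3) by (simp add: factor flipped_def Let_def mult.commute)
qed

text \<open>The word reversed with \<open>x\<close> and \<open>y\<close> exchanged is the word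
  itself. The point is the resulting identity between the two off-diagonal entries.\<close>

lemma flipped_kmot_word:
  assumes "odd \<alpha>" "\<And>i. i \<in> {1..<\<alpha>} \<Longrightarrow> \<epsilon> i = \<epsilon> (\<alpha> - i)"
  shows "flipped l (\<rho> (kmot_word \<alpha> \<epsilon>)) (\<rho> (kmot_word \<alpha> \<epsilon>))"
proof -
  \<comment> \<open>The prefix of length \<open>j\<close> flips to the suffix of length
    \<open>j\<close>; for \<open>j = \<alpha> - 1\<close> both are the whole word.\<close>
  have "flipped l (factors [1..<Suc j]) (factors [\<alpha> - j..<\<alpha>])" if "j < \<alpha>" for j
    using that
  proof (induction j)
    case 0
    then show ?case
      by (simp add: flipped_one)
  next
    case (Suc j)
    have "[\<alpha> - Suc j..<\<alpha>] = (\<alpha> - Suc j) # [\<alpha> - j..<\<alpha>]"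
      using Suc.prems by (simp add: upt_conv_Cons Suc_diff_Suc)
    then show ?case
      using flipped_mult[OF Suc.IH flipped_factor[OF assms, of "Suc j"]] Suc.prems by simp
  qed
  from this[of "\<alpha> - 1"] assms(1) show ?thesis
    by (simp add: rho_kmot_word odd_pos Suc_leI)
qed

lemma det_rho:
  assumes "u \<in> carrier F_xy"
  shows "\<rho> u $ 1 $ 1 * \<rho> u $ 2 $ 2 - \<rho> u $ 1 $ 2 * \<rho> u $ 2 $ 1 = 1"
  using hom_closed[OF assms] by (simp add: SL2_def det_2)

text \<open>In the basis \<open>(1, m' - m)\<close>, \<open>(0, 1)\<close> the generators \<open>x\<close> and \<open>y\<close> become
  \<open>((m', 1), (0, m))\<close> and \<open>((m, 0), (\<mu>, m'))\<close>, and the first row of a product of their powers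
  is a sum over walks on two states. The even and odd coefficients of \<open>ctilde\<close> collect the
  walks that end in the first and in the second state.\<close>

lemma first_row:
  fixes h :: "laurent \<Rightarrow> 'a"
  assumes h_add: "\<And>p q. h (p + q) = h p + h q"
    and h_mult: "\<And>p q. h (p * q) = h p * h q"
    and h_of_int: "\<And>c. h (of_int c) = of_int c"
    and h_Mpow: "h (Mpow 1) = m" "h (Mpow (- 1)) = m'"
    and "n < \<alpha>" "n \<le> 2 * N"
  defines "z \<equiv> m - m'"
  defines "\<mu> \<equiv> l + z\<^sup>2"
  defines "W \<equiv> factors [1..<Suc n]"
  shows "W $ 1 $ 1 - z * W $ 1 $ 2 = (\<Sum>k=0..N. h (ctilde \<epsilon> n (2 * k)) * \<mu> ^ k) \<and>
         W $ 1 $ 2 = (\<Sum>k=0..N. h (ctilde \<epsilon> n (2 * k + 1)) * \<mu> ^ k)"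
  using \<open>n < \<alpha>\<close> \<open>n \<le> 2 * N\<close> unfolding W_def
\<comment> \<open>The bound \<open>N\<close> stays fixed, so the sums keep their range throughout;
  coefficients beyond \<open>n\<close> are zero.\<close>
proof (induction n)
  case 0
  have h01: "h 0 = 0" "h 1 = 1"
    using h_of_int[of 0] h_of_int[of 1] by simp_all
  have c: "ctilde \<epsilon> 0 k = (if k = 0 then 1 else 0)" for k
    by (auto simp: ctilde_eq_0) (simp add: ctilde_def alt_hat_def)
  show ?case
    by (simp add: mat_def c h01 if_distrib if_distribR sum.delta cong: if_cong)
next
  case (Suc n)
  define A where "A = (\<lambda>n. \<Sum>k=0..N. h (ctilde \<epsilon> n (2 * k)) * \<mu> ^ k)"
  define B where "B = (\<lambda>n. \<Sum>k=0..N. h (ctilde \<epsilon> n (2 * k + 1)) * \<mu> ^ k)"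
  define e where "e = \<epsilon> (Suc n)"
  define u where "u = (if e = 1 then m else m')"
  define v where "v = (if e = 1 then m' else m)"
  define W where "W = factors [1..<Suc n]"
  have e: "e = 1 \<or> e = - 1"
    unfolding e_def by (rule sign) (use Suc.prems in auto)
  have uv: "h (Mpow e) = u" "h (Mpow (- e)) = v" and h0: "h 0 = 0"
    using e h_Mpow h_of_int[of 0] by (auto simp: u_def v_def)
  have u: "u = v + of_int e * z"
    using e by (auto simp: u_def v_def z_def)
  have W': "factors [1..<Suc (Suc n)] = W ** factor (Suc n)"
    by (simp add: W_def)
  have F: "factor (Suc n) =
      (if even n then mat2 u (of_int e) 0 v else mat2 u 0 (of_int e * l) v)"
    using Suc.prems by (simp add: factor u_def v_def e_def Let_def)
  have W: "W $ 1 $ 1 = A n + z * B n" "W $ 1 $ 2 = B n"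
    using Suc.IH Suc.prems by (auto simp: A_def B_def W_def algebra_simps)
  have AB: "(\<Sum>k=0..N. h (ctilde \<epsilon> (Suc n) (2 * k)) * \<mu> ^ k) = A (Suc n)"
      "(\<Sum>k=0..N. h (ctilde \<epsilon> (Suc n) (2 * k + 1)) * \<mu> ^ k) = B (Suc n)"
    by (simp_all only: A_def B_def)
  show ?case
  proof (cases "even n")
    case True
    \<comment> \<open>Here the new factor is a power of \<open>x\<close>. By
      \<open>u = v + of_int e * z\<close>, the matrix product obeys the same recurrence as these
      coefficient sums.\<close>
    have "A (Suc n) = v * A n"
      using True by (simp add: A_def ctilde_Suc h_mult uv flip: e_def)
        (simp add: sum_distrib_left mult_ac)
    moreover have "B (Suc n) = u * B n + of_int e * A n"
      using True by (simp add: A_def B_def ctilde_Suc h_mult h_add h_of_int uv flip: e_def)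
        (simp add: sum_distrib_left sum.distrib algebra_simps)
    ultimately show ?thesis
      using True
      unfolding W' F AB
      by (simp add: matrix_mult_2 W u algebra_simps)
  next
    case False
    \<comment> \<open>The new factor is a power of \<open>y\<close>, which leads from the second
      state back to the first at the cost of one \<open>\<mu>\<close>. Raising the upper limit adds
      only the coefficient of index \<open>2 * N + 1\<close>, which exceeds \<open>n\<close>;
      shifting \<open>k\<close> then releases the factor \<open>\<mu>\<close>.\<close>
    have "(\<Sum>k=0..N. (if 0 < k then h (ctilde \<epsilon> n (2 * k - 1)) else 0) * \<mu> ^ k) = \<mu> * B n"
    proof -
      have "(\<Sum>k=0..N. (if 0 < k then h (ctilde \<epsilon> n (2 * k - 1)) else 0) * \<mu> ^ k)
          = (\<Sum>k=0..Suc N. (if 0 < k then h (ctilde \<epsilon> n (2 * k - 1)) else 0) * \<mu> ^ k)"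
        using Suc.prems by (simp add: ctilde_eq_0 h0)
      also have "\<dots> = (\<Sum>k=0..N. h (ctilde \<epsilon> n (2 * k + 1)) * \<mu> ^ Suc k)"
        by (subst sum.atLeast0_atMost_Suc_shift) simp
      finally show ?thesis
        by (simp add: B_def sum_distrib_left mult_ac)
    qed
    moreover have "A (Suc n) = u * A n + of_int e *
        (\<Sum>k=0..N. (if 0 < k then h (ctilde \<epsilon> n (2 * k - 1)) else 0) * \<mu> ^ k)"
      unfolding A_def sum_distrib_left sum.distrib[symmetric]
      using False
      by (intro sum.cong refl)
         (auto simp: ctilde_Suc h_mult h_add h_of_int h0 uv algebra_simps simp flip: e_def)
    moreover have "B (Suc n) = v * B n"
      using False by (simp add: B_def ctilde_Suc h_mult uv flip: e_def)
        (simp add: sum_distrib_left mult_ac)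
    ultimately show ?thesis
      using False
      unfolding W' F AB
      by (simp add: matrix_mult_2 W u \<mu>_def power2_eq_square algebra_simps)
  qed
qed

section \<open>The defining relation and the quotient group\<close>

lemma rho_relator_eq_one_iff:
  "\<rho> (kmot_relator \<alpha> \<epsilon>) = \<one>\<^bsub>SL2\<^esub> \<longleftrightarrow>
     \<rho> (kmot_word \<alpha> \<epsilon>) ** mat2 m 1 0 m' = mat2 m 0 l m' ** \<rho> (kmot_word \<alpha> \<epsilon>)"
proof -
  have "\<rho> (kmot_relator \<alpha> \<epsilon>) = \<one>\<^bsub>SL2\<^esub> \<longleftrightarrow>
      \<rho> (kmot_word \<alpha> \<epsilon>) \<otimes>\<^bsub>SL2\<^esub> \<rho> (free_gen X) = \<rho> (free_gen Y) \<otimes>\<^bsub>SL2\<^esub> \<rho> (kmot_word \<alpha> \<epsilon>)"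
    unfolding kmot_relator_def
    by (simp add: free_gen_closed kmot_word_closed)
       (metis H.inv_closed H.inv_equality H.inv_inv H.inv_mult_group H.m_closed H.r_inv free_gen_closed
         hom_closed kmot_word_closed)
  then show ?thesis
    by (simp add: SL2_def rho_X rho_Y)
qed

text \<open>Of the four entries of the relation, the top left is trivial, the bottom right is
  \<open>W21\<close>, the top right is the Riley condition, and the bottom left is \<open>l\<close>
  times that condition.\<close>

lemma rho_relator_eq_one_iff_riley:
  assumes "odd \<alpha>" "\<And>i. i \<in> {1..<\<alpha>} \<Longrightarrow> \<epsilon> i = \<epsilon> (\<alpha> - i)"
  defines "W \<equiv> \<rho> (kmot_word \<alpha> \<epsilon>)"
  shows "\<rho> (kmot_relator \<alpha> \<epsilon>) = \<one>\<^bsub>SL2\<^esub> \<longleftrightarrow> W $ 1 $ 1 - (m - m') * W $ 1 $ 2 = 0"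
proof -
  have W21: "W $ 2 $ 1 = l * W $ 1 $ 2"
    using flipped_kmot_word[OF assms(1,2)] by (simp add: flipped_def W_def)
  have "W $ 1 $ 1 - (m - m') * W $ 1 $ 2 = 0 \<longleftrightarrow> W $ 1 $ 1 + W $ 1 $ 2 * m' = m * W $ 1 $ 2"
    by (auto simp: algebra_simps)
  moreover have "l * (W $ 1 $ 1 + W $ 1 $ 2 * m') = l * (m * W $ 1 $ 2)
      \<Longrightarrow> W $ 2 $ 1 * m = l * W $ 1 $ 1 + m' * W $ 2 $ 1"
    unfolding W21 by (simp add: algebra_simps)
  ultimately show ?thesis
    unfolding rho_relator_eq_one_iff W_def[symmetric]
    by (auto simp: mat2_eq_iff matrix_mult_2 W21 mult_ac)
qed

text \<open>Universal property of the quotient: the kernel of \<open>\<rho>\<close> is a subgroup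
  that contains all conjugates of the relator once it contains the relator, hence also their normal
  closure.\<close>

lemma factors_iff_relator:
  "(\<exists>\<phi>\<in>hom (kmot_group \<alpha> \<epsilon>) SL2. \<forall>u\<in>carrier F_xy. \<rho> u = \<phi> (kmot_proj \<alpha> \<epsilon> u)) \<longleftrightarrow>
     \<rho> (kmot_relator \<alpha> \<epsilon>) = \<one>\<^bsub>SL2\<^esub>"
proof
  have relator: "kmot_relator \<alpha> \<epsilon> \<in> carrier F_xy"
    by (simp add: kmot_relator_def free_gen_closed kmot_word_closed)
  let ?C = "{g \<otimes>\<^bsub>F_xy\<^esub> r \<otimes>\<^bsub>F_xy\<^esub> inv\<^bsub>F_xy\<^esub> g | g r. g \<in> carrier F_xy \<and> r \<in> {kmot_relator \<alpha> \<epsilon>}}"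
  {
    assume "\<exists>\<phi>\<in>hom (kmot_group \<alpha> \<epsilon>) SL2. \<forall>u\<in>carrier F_xy. \<rho> u = \<phi> (kmot_proj \<alpha> \<epsilon> u)"
    then obtain \<phi> where \<phi>: "\<And>u. u \<in> carrier F_xy \<Longrightarrow> \<rho> u = \<phi> (kmot_proj \<alpha> \<epsilon> u)"
      by blast
    have "kmot_relator \<alpha> \<epsilon> = \<one>\<^bsub>F_xy\<^esub> \<otimes>\<^bsub>F_xy\<^esub> kmot_relator \<alpha> \<epsilon> \<otimes>\<^bsub>F_xy\<^esub> inv\<^bsub>F_xy\<^esub> \<one>\<^bsub>F_xy\<^esub>"
      using relator by simp
    then have "kmot_relator \<alpha> \<epsilon> \<in> ?C"
      by blast
    then have "kmot_relator \<alpha> \<epsilon> \<in> kmot_kernel \<alpha> \<epsilon>"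
      unfolding kmot_kernel_def normal_closure_def by (rule generate.incl)
    then have "kmot_proj \<alpha> \<epsilon> (kmot_relator \<alpha> \<epsilon>) = kmot_proj \<alpha> \<epsilon> \<one>\<^bsub>F_xy\<^esub>"
      unfolding kmot_proj_def
      by (metis G.coset_join2 G.one_closed kmot_kernel_normal normal_imp_subgroup relator
          subgroup.one_closed)
    then show "\<rho> (kmot_relator \<alpha> \<epsilon>) = \<one>\<^bsub>SL2\<^esub>"
      using \<phi> relator by (metis G.one_closed hom_one)
  }
  assume "\<rho> (kmot_relator \<alpha> \<epsilon>) = \<one>\<^bsub>SL2\<^esub>"
  then have "?C \<subseteq> kernel F_xy SL2 \<rho>"
    using relator by (auto simp: kernel_def)
  then have "kmot_kernel \<alpha> \<epsilon> \<subseteq> kernel F_xy SL2 \<rho>"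
    unfolding kmot_kernel_def normal_closure_def
    by (rule G.generate_subgroup_incl[OF _ subgroup_kernel])
  then obtain \<phi> where "\<phi> \<in> hom (kmot_group \<alpha> \<epsilon>) SL2"
      "\<And>u. u \<in> carrier F_xy \<Longrightarrow> \<phi> (kmot_proj \<alpha> \<epsilon> u) = \<rho> u"
    using FactGroup_universal_kernel[OF kmot_kernel_normal]
    unfolding kmot_group_def kmot_proj_def by metis
  then show "\<exists>\<phi>\<in>hom (kmot_group \<alpha> \<epsilon>) SL2. \<forall>u\<in>carrier F_xy. \<rho> u = \<phi> (kmot_proj \<alpha> \<epsilon> u)"
    by metis
qed

text \<open>If the images of the generators commute, then \<open>l = 0\<close> and \<open>m = m'\<close>, and a vanishing
  Riley polynomial would make the first column of \<open>\<rho> w\<close> zero.\<close>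

lemma generators_not_commute:
  assumes "(1::'a) \<noteq> 0" "odd \<alpha>" "\<And>i. i \<in> {1..<\<alpha>} \<Longrightarrow> \<epsilon> i = \<epsilon> (\<alpha> - i)"
    and "\<rho> (kmot_relator \<alpha> \<epsilon>) = \<one>\<^bsub>SL2\<^esub>"
  shows "\<rho> (free_gen X) \<otimes>\<^bsub>SL2\<^esub> \<rho> (free_gen Y) \<noteq> \<rho> (free_gen Y) \<otimes>\<^bsub>SL2\<^esub> \<rho> (free_gen X)"
proof
  assume "\<rho> (free_gen X) \<otimes>\<^bsub>SL2\<^esub> \<rho> (free_gen Y) = \<rho> (free_gen Y) \<otimes>\<^bsub>SL2\<^esub> \<rho> (free_gen X)"
  then have "l = 0" "m = m'"
    by (simp_all add: SL2_def rho_X rho_Y mat2_eq_iff matrix_mult_2)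
  moreover have "\<rho> (kmot_word \<alpha> \<epsilon>) $ 2 $ 1 = l * \<rho> (kmot_word \<alpha> \<epsilon>) $ 1 $ 2"
    using flipped_kmot_word[OF assms(2,3)] by (simp add: flipped_def)
  moreover have "\<rho> (kmot_word \<alpha> \<epsilon>) $ 1 $ 1 - (m - m') * \<rho> (kmot_word \<alpha> \<epsilon>) $ 1 $ 2 = 0"
    using rho_relator_eq_one_iff_riley[OF assms(2,3)] assms(4) by blast
  ultimately show False
    using det_rho[OF kmot_word_closed, of \<alpha> \<epsilon>] assms(1) by simp
qed

text \<open>Every factorization through the quotient is automatically non-abelian, as witnessed by
  the classes of the two generators.\<close>

lemma nonabelian_factors_iff:
  assumes "(1::'a) \<noteq> 0" "odd \<alpha>" "\<And>i. i \<in> {1..<\<alpha>} \<Longrightarrow> \<epsilon> i = \<epsilon> (\<alpha> - i)"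
  shows "(\<exists>\<phi>. nonabelian_rep (kmot_group \<alpha> \<epsilon>) SL2 \<phi> \<and>
              (\<forall>u\<in>carrier F_xy. \<rho> u = \<phi> (kmot_proj \<alpha> \<epsilon> u))) \<longleftrightarrow>
         \<rho> (kmot_relator \<alpha> \<epsilon>) = \<one>\<^bsub>SL2\<^esub>"
proof
  assume "\<exists>\<phi>. nonabelian_rep (kmot_group \<alpha> \<epsilon>) SL2 \<phi> \<and>
              (\<forall>u\<in>carrier F_xy. \<rho> u = \<phi> (kmot_proj \<alpha> \<epsilon> u))"
  then show "\<rho> (kmot_relator \<alpha> \<epsilon>) = \<one>\<^bsub>SL2\<^esub>"
    unfolding factors_iff_relator[symmetric] nonabelian_rep_def by blast
next
  assume rel: "\<rho> (kmot_relator \<alpha> \<epsilon>) = \<one>\<^bsub>SL2\<^esub>"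
  then obtain \<phi> where \<phi>: "\<phi> \<in> hom (kmot_group \<alpha> \<epsilon>) SL2"
      "\<forall>u\<in>carrier F_xy. \<rho> u = \<phi> (kmot_proj \<alpha> \<epsilon> u)"
    unfolding factors_iff_relator[symmetric] by blast
  have "kmot_proj \<alpha> \<epsilon> (free_gen g) \<in> carrier (kmot_group \<alpha> \<epsilon>)" for g
    using kmot_proj_hom free_gen_closed by (rule hom_in_carrier)
  then have "nonabelian_rep (kmot_group \<alpha> \<epsilon>) SL2 \<phi>"
    unfolding nonabelian_rep_def
    using \<phi> generators_not_commute[OF assms rel] free_gen_closed by metis
  with \<phi>(2) show "\<exists>\<phi>. nonabelian_rep (kmot_group \<alpha> \<epsilon>) SL2 \<phi> \<and>
              (\<forall>u\<in>carrier F_xy. \<rho> u = \<phi> (kmot_proj \<alpha> \<epsilon> u))"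
    by blast
qed

end

theorem theorem5p6:
  fixes \<alpha> :: nat and \<epsilon> :: "nat \<Rightarrow> int" and M l z :: complex
    and \<rho> :: "xy fword \<Rightarrow> complex ^ 2 ^ 2"
  assumes "odd \<alpha>" and "\<alpha> \<ge> 3"
    and "\<forall>i\<in>{1..\<alpha> - 1}. \<epsilon> i \<in> {1, -1} \<and> \<epsilon> i = \<epsilon> (\<alpha> - i)"
    and "M \<noteq> 0"
    and "\<rho> \<in> hom F_xy SL2"
    and "\<rho> (free_gen X) = mat2 M 1 0 (1 / M)"
    and "\<rho> (free_gen Y) = mat2 M 0 l (1 / M)"
    and "z = M - 1 / M"
  shows "((\<exists>\<phi>. nonabelian_rep (kmot_group \<alpha> \<epsilon>) SL2 \<phi> \<and>
              (\<forall>u\<in>carrier F_xy. \<rho> u = \<phi> (kmot_proj \<alpha> \<epsilon> u)))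
          \<longleftrightarrow> eval_at M (l + z\<^sup>2) (f_poly \<epsilon> (\<alpha> - 1)) = 0)
       \<and> pcompose (f_poly \<epsilon> (\<alpha> - 1)) [:z_laurent\<^sup>2, 1:] = riley_poly \<alpha> \<epsilon>"
proof -
  have sign: "\<epsilon> i = 1 \<or> \<epsilon> i = - 1" and sym: "\<epsilon> i = \<epsilon> (\<alpha> - i)" if "i \<in> {1..<\<alpha>}" for i
  proof -
    from that have "i \<in> {1..\<alpha> - 1}" by auto
    then show "\<epsilon> i = 1 \<or> \<epsilon> i = - 1" "\<epsilon> i = \<epsilon> (\<alpha> - i)"
      using assms(3) by blast+
  qed
  interpret spec: kmot_rep \<alpha> \<epsilon> M "1 / M" l \<rho>
    by unfold_locales (use sign assms(4-7) in auto)
  interpret generic: kmot_rep \<alpha> \<epsilon> "[:Mpow 1:]" "[:Mpow (- 1):]" "[:0, 1:]" generic_rho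
    by unfold_locales (use sign generic_rho in \<open>auto simp: mult_single one_pCons\<close>)
  \<comment> \<open>Since \<open>\<alpha> - 1\<close> is even, half of it is an admissible
    \<open>N\<close>, and it is the summation bound in \<open>f_poly\<close>.\<close>
  have n: "\<alpha> - 1 < \<alpha>" "\<alpha> - 1 \<le> 2 * ((\<alpha> - 1) div 2)" "Suc (\<alpha> - 1) = \<alpha>"
    using assms(1,2) by auto
  \<comment> \<open>Specializing the Laurent variable to \<open>M\<close> yields the complex value
    of the polynomial.\<close>
  note row = spec.first_row[where h = "laurent_eval M", OF laurent_eval_add laurent_eval_mult[OF assms(4)]
      laurent_eval_of_int _ _ n(1,2), THEN conjunct1]
  have "eval_at M (l + z\<^sup>2) (f_poly \<epsilon> (\<alpha> - 1)) =
      \<rho> (kmot_word \<alpha> \<epsilon>) $ 1 $ 1 - (M - 1 / M) * \<rho> (kmot_word \<alpha> \<epsilon>) $ 1 $ 2"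
    unfolding eval_at_f_poly spec.rho_kmot_word assms(8)
    using row n(3) by (simp add: power_int_minus divide_inverse)
  then have 1: "\<rho> (kmot_relator \<alpha> \<epsilon>) = \<one>\<^bsub>SL2\<^esub> \<longleftrightarrow> eval_at M (l + z\<^sup>2) (f_poly \<epsilon> (\<alpha> - 1)) = 0"
    using spec.rho_relator_eq_one_iff_riley[OF assms(1) sym] by simp
  have of_int: "[:of_int c :: laurent:] = of_int c" for c
    by (simp add: of_int_poly)
  have q: "[:0, 1:] + ([:Mpow 1:] - [:Mpow (- 1):])\<^sup>2 = [:z_laurent\<^sup>2, 1:]"
    by (simp add: z_laurent_def power2_eq_square)
  \<comment> \<open>With the embedding of coefficients as constant polynomials, the same expansion
    becomes an identity over the Laurent ring.\<close>
  note row = generic.first_row[where h = "\<lambda>p. [:p:]", OF _ _ of_int refl refl n(1,2), THEN conjunct1]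
  have 2: "pcompose (f_poly \<epsilon> (\<alpha> - 1)) [:z_laurent\<^sup>2, 1:] = riley_poly \<alpha> \<epsilon>"
    unfolding pcompose_f_poly riley_poly_def Let_def generic.rho_kmot_word
    using row n(3) unfolding q by (simp add: z_laurent_def)
  show ?thesis
    using spec.nonabelian_factors_iff[OF _ assms(1) sym] 1 2 by simp
qed

end
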